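(* Let $n\in\mathbb{N}$, let $G=\mathbb{Q}^n$ (additive group), and let $\preceq\in \mathrm{ZR}(G)\setminus\{\preceq_\emptyset\}$. Then there exist preorders $\preceq_1,\dots,\preceq_n\in\mathrm{ZR}(G)$, each of rank $1$, such that $$\preceq\;=\;\preceq_1\circ\cdots\circ\preceq_n.$$
   Context: $\mathrm{ZR}(G)$ is the set of bi-invariant preorders on the group $G$: binary relations $\preceq$ that are total ($u\preceq v$ or $v\preceq u$ for all $u,v$), transitive, and invariant under translation on both sides (for abelian $G$, written additively: $u\preceq v\Rightarrow w+u\preceq w+v$; left-invariant, right-invariant and bi-invariant preorders then coincide). The trivial preorder $\preceq_\emptyset$ satisfies $u\preceq_\emptyset v$ for all $u,v$. Write $u\prec v$ if $u\preceq v$ and not $v\preceq u$; $u\sim_\preceq v$ if $u\preceq v$ and $v\preceq u$. Composition: $\preceq_1\circ\preceq_2\in\mathrm{ZR}(G)$ is the preorder for which $u$ is $\preceq_1\circ\preceq_2$-below $v$ iff $u\prec_1 v$, or $u\sim_{\preceq_1}v$ and $u\preceq_2 v$. Composition is associative. Rank: $\preceq'\,\boldsymbol{\le}\,\preceq$ means that $\preceq$ refines $\preceq'$, i.e. $u\preceq v\Rightarrow u\preceq' v$ for all $u,v$. Put $\mathrm{Raf}^-(\preceq)=\{\preceq'\in\mathrm{ZR}(G)\mid\preceq'\,\boldsymbol{\le}\,\preceq\}$. The rank of $\preceq$ is $\#\mathrm{Raf}^-(\preceq)-1$ if this cardinal is finite, and $\#\mathrm{Raf}^-(\preceq)$ otherwise.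 *)

theory Defs
  imports "Jordan_Normal_Form.Matrix"
begin

text \<open>
  A preorder on a group \<open>G\<close> is encoded as a set of pairs contained in
  \<open>carrier G \<times> carrier G\<close>, so that equality and counting of preorders only see the
  elements of \<open>G\<close>.
\<close>

definition ZR :: "('a, 'b) monoid_scheme \<Rightarrow> 'a rel set" where
  "ZR G = {p. p \<subseteq> carrier G \<times> carrier G
      \<and> (\<forall>u\<in>carrier G. \<forall>v\<in>carrier G. (u, v) \<in> p \<or> (v, u) \<in> p)
      \<and> trans p
      \<and> (\<forall>u\<in>carrier G. \<forall>v\<in>carrier G. \<forall>w\<in>carrier G. (u, v) \<in> p \<longrightarrow>
            (w \<otimes>\<^bsub>G\<^esub> u, w \<otimes>\<^bsub>G\<^esub> v) \<in> p \<and> (u \<otimes>\<^bsub>G\<^esub> w, v \<otimes>\<^bsub>G\<^esub> w) \<in> p)}"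

definition trivial_preorder :: "('a, 'b) monoid_scheme \<Rightarrow> 'a rel" where
  "trivial_preorder G = carrier G \<times> carrier G"

definition strict_below :: "'a rel \<Rightarrow> 'a \<Rightarrow> 'a \<Rightarrow> bool" where
  "strict_below p u v \<longleftrightarrow> (u, v) \<in> p \<and> (v, u) \<notin> p"

definition equiv_under :: "'a rel \<Rightarrow> 'a \<Rightarrow> 'a \<Rightarrow> bool" where
  "equiv_under p u v \<longleftrightarrow> (u, v) \<in> p \<and> (v, u) \<in> p"

definition preorder_comp :: "'a rel \<Rightarrow> 'a rel \<Rightarrow> 'a rel" where
  "preorder_comp p q = {(u, v). strict_below p u v \<or> equiv_under p u v \<and> (u, v) \<in> q}"

text \<open>The iterated composition starts from the trivial preorder, which is the neutral element.\<close>

definition preorder_comp_list :: "('a, 'b) monoid_scheme \<Rightarrow> 'a rel list \<Rightarrow> 'a rel" where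
  "preorder_comp_list G ps = foldr preorder_comp ps (trivial_preorder G)"

lemma preorder_comp_trivial_right:
  assumes "p \<in> ZR G"
  shows "preorder_comp p (trivial_preorder G) = p"
  using assms
  by (auto simp: ZR_def preorder_comp_def strict_below_def equiv_under_def trivial_preorder_def)

lemma preorder_comp_list_singleton: "p \<in> ZR G \<Longrightarrow> preorder_comp_list G [p] = p"
  by (simp add: preorder_comp_list_def preorder_comp_trivial_right)

lemma preorder_comp_list_Cons: "preorder_comp_list G (p # ps) = preorder_comp p (preorder_comp_list G ps)"
  by (simp add: preorder_comp_list_def)

definition refines :: "'a rel \<Rightarrow> 'a rel \<Rightarrow> bool" where
  "refines p p' \<longleftrightarrow> (\<forall>u v. (u, v) \<in> p \<longrightarrow> (u, v) \<in> p')"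

definition Raf_minus :: "('a, 'b) monoid_scheme \<Rightarrow> 'a rel \<Rightarrow> 'a rel set" where
  "Raf_minus G p = {p' \<in> ZR G. refines p p'}"

text \<open>
  The rank is a possibly infinite cardinal, and cardinals are well-orders up to \<open>=o\<close>;
  hence the predicate \<open>has_rank G p \<kappa>\<close>, which determines \<open>\<kappa>\<close> up to \<open>=o\<close>.
  The finite cardinal \<open>k\<close> is \<open>|{..<k}|\<close>.
\<close>

context includes cardinal_syntax
begin

definition has_rank :: "('a, 'b) monoid_scheme \<Rightarrow> 'a rel \<Rightarrow> 'c rel \<Rightarrow> bool" where
  "has_rank G p \<kappa> \<longleftrightarrow>
     (if finite (Raf_minus G p) then \<kappa> =o |{..<card (Raf_minus G p) - 1}|
      else \<kappa> =o |Raf_minus G p| )"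

end

abbreviation rat_space :: "nat \<Rightarrow> rat vec monoid" where
  "rat_space n \<equiv> monoid_vec TYPE(rat) n"

end

theory Submission
  imports Defs "HOL-Library.Function_Algebras"
begin

text \<open>
  A bi-invariant preorder \<open>p\<close> on an abelian group \<open>G\<close> is governed by the subgroup \<open>K\<close> of elements
  equivalent to the identity, because \<open>G / K\<close> is totally ordered by \<open>p\<close>. A coarsening of \<open>p\<close> is
  determined by its own such subgroup (\<open>coarsening_eqI\<close>), and being the kernel of a map to a totally
  ordered group, \<open>K\<close> is isolated: it contains \<open>x\<close> as soon as it contains a positive power of \<open>x\<close>
  (\<open>isolated_unit_class\<close>). In \<open>\<rat>\<^sup>n\<close> the isolated subgroups are the linear subspaces. Hence proper
  coarsening strictly lowers the codimension of \<open>K\<close>, so that every nontrivial preorder has a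
  coarsening of rank 1 (\<open>exists_rank_one_coarsening\<close>).

  Let \<open>p'\<close> be a rank 1 coarsening of \<open>p\<close>, with subspace \<open>K'\<close>, and let \<open>\<pi>\<close> be a linear projection onto
  \<open>K'\<close>. The preorder \<open>q\<close> that compares \<open>\<pi> u\<close> with \<open>\<pi> v\<close> by \<open>p\<close> agrees with \<open>p\<close> on
  differences in \<open>K'\<close>, whence \<open>p = p' \<circ> q\<close>; and its subspace contains both \<open>K\<close> and the nonzero
  kernel of \<open>\<pi>\<close>, so it has smaller codimension than \<open>K\<close> (\<open>split_off_coarsening\<close>). Repeating this with
  \<open>q\<close> in place of \<open>p\<close>, as long as \<open>q\<close> is nontrivial, produces between 1 and \<open>n\<close> factors of rank 1. Since
  \<open>p\<^sub>1 \<circ> (p\<^sub>1 \<circ> r) = p\<^sub>1 \<circ> r\<close>, repeating the first factor brings their number up to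
  exactly \<open>n\<close>.

  The order-theoretic part is carried out in any abelian group whose isolated subgroups are retracts
  and carry a strictly decreasing natural-number valued corank.
\<close>

section \<open>The class of the identity of an invariant preorder\<close>

definition isolated_subgroup :: "('a, 'b) monoid_scheme \<Rightarrow> 'a set \<Rightarrow> bool" where
  "isolated_subgroup G H \<longleftrightarrow> subgroup H G \<and>
     (\<forall>x\<in>carrier G. \<forall>m::nat. m > 0 \<longrightarrow> x [^]\<^bsub>G\<^esub> m \<in> H \<longrightarrow> x \<in> H)"

definition unit_class :: "('a, 'b) monoid_scheme \<Rightarrow> 'a rel \<Rightarrow> 'a set" where
  "unit_class G p = {x \<in> carrier G. equiv_under p \<one>\<^bsub>G\<^esub> x}"

lemma ZR_carrier: "p \<in> ZR G \<Longrightarrow> (u, v) \<in> p \<Longrightarrow> u \<in> carrier G \<and> v \<in> carrier G"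
  by (auto simp: ZR_def)

lemma ZR_total:
  "p \<in> ZR G \<Longrightarrow> u \<in> carrier G \<Longrightarrow> v \<in> carrier G \<Longrightarrow> (u, v) \<in> p \<or> (v, u) \<in> p"
  by (auto simp: ZR_def)

lemma ZR_refl: "p \<in> ZR G \<Longrightarrow> u \<in> carrier G \<Longrightarrow> (u, u) \<in> p"
  using ZR_total[of p G u u] by simp

lemma ZR_trans: "p \<in> ZR G \<Longrightarrow> (u, v) \<in> p \<Longrightarrow> (v, w) \<in> p \<Longrightarrow> (u, w) \<in> p"
  unfolding ZR_def by (simp, elim conjE, erule (2) transD)

lemma ZR_left_mult:
  "p \<in> ZR G \<Longrightarrow> (u, v) \<in> p \<Longrightarrow> w \<in> carrier G \<Longrightarrow> (w \<otimes>\<^bsub>G\<^esub> u, w \<otimes>\<^bsub>G\<^esub> v) \<in> p"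
  by (auto simp: ZR_def)

lemma (in monoid) unit_class_trivial: "unit_class G (trivial_preorder G) = carrier G"
  by (auto simp: unit_class_def trivial_preorder_def equiv_under_def)

lemma unit_class_mono: "p \<subseteq> p' \<Longrightarrow> unit_class G p \<subseteq> unit_class G p'"
  by (auto simp: unit_class_def equiv_under_def)

context comm_group
begin

lemma ZR_diff_iff:
  assumes p: "p \<in> ZR G" and uv: "u \<in> carrier G" "v \<in> carrier G"
  shows "(\<one>, inv u \<otimes> v) \<in> p \<longleftrightarrow> (u, v) \<in> p" and "(inv u \<otimes> v, \<one>) \<in> p \<longleftrightarrow> (v, u) \<in> p"
proof -
  have "u \<otimes> (inv u \<otimes> v) = v" using uv by (simp add: m_assoc[symmetric])
  then show "(\<one>, inv u \<otimes> v) \<in> p \<longleftrightarrow> (u, v) \<in> p" "(inv u \<otimes> v, \<one>) \<in> p \<longleftrightarrow> (v, u) \<in> p"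
    using ZR_left_mult[OF p, of \<one> "inv u \<otimes> v" u] ZR_left_mult[OF p, of "inv u \<otimes> v" \<one> u]
      ZR_left_mult[OF p, of u v "inv u"] ZR_left_mult[OF p, of v u "inv u"] uv
    by auto
qed

lemma equiv_iff_unit_class:
  assumes "p \<in> ZR G" "u \<in> carrier G" "v \<in> carrier G"
  shows "equiv_under p u v \<longleftrightarrow> inv u \<otimes> v \<in> unit_class G p"
  using ZR_diff_iff[OF assms] assms by (auto simp: unit_class_def equiv_under_def)

lemma subgroup_unit_class:
  assumes p: "p \<in> ZR G"
  shows "subgroup (unit_class G p) G"
proof (rule subgroupI)
  show "unit_class G p \<subseteq> carrier G" by (auto simp: unit_class_def)
  show "unit_class G p \<noteq> {}"
    using ZR_refl[OF p one_closed] by (auto simp: unit_class_def equiv_under_def)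
  fix a assume a: "a \<in> unit_class G p"
  then show "inv a \<in> unit_class G p"
    using ZR_diff_iff[OF p, of a \<one>] by (auto simp: unit_class_def equiv_under_def)
  fix b assume b: "b \<in> unit_class G p"
  have c: "a \<in> carrier G" "b \<in> carrier G" using a b by (auto simp: unit_class_def)
  have "(a, a \<otimes> b) \<in> p" "(a \<otimes> b, a) \<in> p"
    using b c ZR_left_mult[OF p, of \<one> b a] ZR_left_mult[OF p, of b \<one> a]
    by (auto simp: unit_class_def equiv_under_def)
  with a have "(\<one>, a \<otimes> b) \<in> p" "(a \<otimes> b, \<one>) \<in> p"
    using ZR_trans[OF p, of \<one> a "a \<otimes> b"] ZR_trans[OF p, of "a \<otimes> b" a \<one>]
    by (auto simp: unit_class_def equiv_under_def)
  then show "a \<otimes> b \<in> unit_class G p"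
    using c by (simp add: unit_class_def equiv_under_def)
qed

text \<open>
  Powers of an element above the identity increase, so if some power is equivalent to the identity,
  then so is the element, which lies in between.
\<close>

lemma isolated_unit_class:
  assumes p: "p \<in> ZR G"
  shows "isolated_subgroup G (unit_class G p)"
  unfolding isolated_subgroup_def
proof (intro conjI ballI allI impI)
  show "subgroup (unit_class G p) G" by (rule subgroup_unit_class[OF p])
  fix x and m :: nat
  assume x: "x \<in> carrier G" and m: "m > 0" and xm: "x [^] m \<in> unit_class G p"
  have up: "(x, x [^] Suc k) \<in> p" if "(\<one>, x) \<in> p" for k
  proof (induction k)
    case 0
    show ?case using ZR_refl[OF p x] x by simp
  next
    case (Suc k)
    have "(x [^] Suc k \<otimes> \<one>, x [^] Suc k \<otimes> x) \<in> p"
      by (rule ZR_left_mult[OF p that]) (use x in auto)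
    then have "(x [^] Suc k, x [^] Suc (Suc k)) \<in> p" using x by simp
    with Suc show ?case by (rule ZR_trans[OF p])
  qed
  have down: "(x [^] Suc k, x) \<in> p" if "(x, \<one>) \<in> p" for k
  proof (induction k)
    case 0
    show ?case using ZR_refl[OF p x] x by simp
  next
    case (Suc k)
    have "(x [^] Suc k \<otimes> x, x [^] Suc k \<otimes> \<one>) \<in> p"
      by (rule ZR_left_mult[OF p that]) (use x in auto)
    then have "(x [^] Suc (Suc k), x [^] Suc k) \<in> p" using x by simp
    then show ?case using Suc by (rule ZR_trans[OF p])
  qed
  obtain k where k: "m = Suc k" using m by (cases m) auto
  have xk: "(\<one>, x [^] Suc k) \<in> p" "(x [^] Suc k, \<one>) \<in> p"
    using xm by (simp_all only: k unit_class_def equiv_under_def mem_Collect_eq)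
  have "(\<one>, x) \<in> p \<or> (x, \<one>) \<in> p" using ZR_total[OF p one_closed x] .
  then have "(\<one>, x) \<in> p \<and> (x, \<one>) \<in> p"
    using ZR_trans[OF p up xk(2)] ZR_trans[OF p xk(1) down] by iprover
  then show "x \<in> unit_class G p"
    using x by (simp only: unit_class_def equiv_under_def mem_Collect_eq)
qed

text \<open>
  If \<open>p'\<close> coarsens \<open>p\<close>, then \<open>u\<close> is \<open>p'\<close>-below \<open>v\<close> exactly if it is \<open>p\<close>-below \<open>v\<close> or
  \<open>p'\<close>-equivalent to \<open>v\<close>, by totality of \<open>p\<close>.
\<close>

lemma coarsening_eqI:
  assumes p: "p \<in> ZR G" and p': "p' \<in> ZR G" and sub: "p \<subseteq> p'"
    and eq: "unit_class G p = unit_class G p'"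
  shows "p = p'"
proof
  show "p' \<subseteq> p"
  proof (clarify, rule ccontr)
    fix u v assume uv: "(u, v) \<in> p'" and n: "(u, v) \<notin> p"
    have c: "u \<in> carrier G" "v \<in> carrier G" using ZR_carrier[OF p' uv] by auto
    have "(v, u) \<in> p'" using ZR_total[OF p c] n sub by auto
    then have "equiv_under p' u v" using uv by (simp add: equiv_under_def)
    then have "equiv_under p u v"
      using equiv_iff_unit_class[OF p c] equiv_iff_unit_class[OF p' c] eq by simp
    then show False using n by (simp add: equiv_under_def)
  qed
qed (rule sub)

lemma unit_class_strict_mono:
  assumes "p \<in> ZR G" "p' \<in> ZR G" "p \<subseteq> p'" "p \<noteq> p'"
  shows "unit_class G p \<subset> unit_class G p'"
  using coarsening_eqI[OF assms(1-3)] unit_class_mono[OF assms(3), of G] assms(4) by blast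

end

lemma trivial_in_ZR:
  assumes "group G"
  shows "trivial_preorder G \<in> ZR G"
proof -
  interpret group G by fact
  show ?thesis by (auto simp: ZR_def trivial_preorder_def trans_def)
qed

lemma ZR_subset_trivial: "p \<in> ZR G \<Longrightarrow> p \<subseteq> trivial_preorder G"
  by (auto simp: ZR_def trivial_preorder_def)

section \<open>Preorders of rank one\<close>

definition rank_one :: "('a, 'b) monoid_scheme \<Rightarrow> 'a rel \<Rightarrow> bool" where
  "rank_one G p \<longleftrightarrow> p \<in> ZR G \<and> p \<noteq> trivial_preorder G \<and>
     (\<forall>p'\<in>ZR G. p \<subseteq> p' \<longrightarrow> p' = p \<or> p' = trivial_preorder G)"

lemma rank_one_has_rank:
  assumes "group G" and r: "rank_one G p"
  shows "has_rank G p (card_of {..<1::nat})"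
proof -
  have "Raf_minus G p = {p, trivial_preorder G}"
    using r trivial_in_ZR[OF assms(1)] ZR_subset_trivial[of p G]
    unfolding Raf_minus_def refines_def rank_one_def by auto
  moreover have "p \<noteq> trivial_preorder G" using r by (simp add: rank_one_def)
  ultimately have "finite (Raf_minus G p)" "card (Raf_minus G p) - 1 = 1" by auto
  then show ?thesis by (simp add: has_rank_def card_of_refl)
qed

lemma preorder_comp_idem: "preorder_comp p (preorder_comp p q) = preorder_comp p q"
  by (auto simp: preorder_comp_def strict_below_def equiv_under_def)

lemma preorder_comp_list_repeat_head:
  "preorder_comp_list G (replicate m p @ p # ps) = preorder_comp_list G (p # ps)"
  by (induction m) (auto simp: preorder_comp_list_Cons preorder_comp_idem)

section \<open>Decomposition in groups whose isolated subgroups are retracts\<close>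

context comm_group
begin

lemma exists_rank_one_coarsening:
  fixes corank :: "'a set \<Rightarrow> nat"
  assumes corank: "\<And>H H'. isolated_subgroup G H \<Longrightarrow> isolated_subgroup G H' \<Longrightarrow> H \<subset> H' \<Longrightarrow>
      corank H' < corank H"
    and "p \<in> ZR G" "p \<noteq> trivial_preorder G"
  shows "\<exists>p'. rank_one G p' \<and> p \<subseteq> p'"
  using assms(2,3)
proof (induction "corank (unit_class G p)" arbitrary: p rule: less_induct)
  case less
  show ?case
  proof (cases "rank_one G p")
    case False
    then obtain p' where p': "p' \<in> ZR G" "p \<subseteq> p'" "p' \<noteq> p" "p' \<noteq> trivial_preorder G"
      using less.prems unfolding rank_one_def by blast
    have "corank (unit_class G p') < corank (unit_class G p)"
      using p' less.prems
      by (intro corank isolated_unit_class unit_class_strict_mono) auto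
    from less.hyps[OF this p'(1,4)] show ?thesis using p'(2) by blast
  qed auto
qed

text \<open>
  The factor \<open>q\<close> extends the restriction of \<open>p\<close> to the unit class of \<open>p'\<close> to the whole group,
  along a retraction; an element moved by the retraction witnesses that the unit class grows.
\<close>

lemma split_off_coarsening:
  assumes p: "p \<in> ZR G" and p': "p' \<in> ZR G" and sub: "p \<subseteq> p'"
    and nontriv: "p' \<noteq> trivial_preorder G"
    and hom: "\<pi> \<in> hom G G" and range: "\<pi> ` carrier G \<subseteq> unit_class G p'"
    and fix_on: "\<And>x. x \<in> unit_class G p' \<Longrightarrow> \<pi> x = x"
  obtains q where "q \<in> ZR G" "p = preorder_comp p' q" "unit_class G p \<subset> unit_class G q"
proof
  define q where "q = {(u, v). u \<in> carrier G \<and> v \<in> carrier G \<and> (\<pi> u, \<pi> v) \<in> p}"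
  interpret \<pi>: group_hom G G \<pi>
    using hom by unfold_locales
  have \<pi>c: "\<pi> x \<in> carrier G" if "x \<in> carrier G" for x
    using that by simp
  show "q \<in> ZR G"
    unfolding ZR_def
  proof (intro CollectI conjI)
    show "trans q"
      using ZR_trans[OF p] by (intro transI) (auto simp: q_def)
    show "\<forall>u\<in>carrier G. \<forall>v\<in>carrier G. (u, v) \<in> q \<or> (v, u) \<in> q"
      using ZR_total[OF p] \<pi>c by (auto simp: q_def)
    show "\<forall>u\<in>carrier G. \<forall>v\<in>carrier G. \<forall>w\<in>carrier G. (u, v) \<in> q \<longrightarrow>
        (w \<otimes> u, w \<otimes> v) \<in> q \<and> (u \<otimes> w, v \<otimes> w) \<in> q"
      using p \<pi>c by (simp add: q_def ZR_def)
  qed (auto simp: q_def)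
  show "p = preorder_comp p' q"
  proof -
    have agree: "(u, v) \<in> p \<longleftrightarrow> (u, v) \<in> preorder_comp p' q"
      if c: "u \<in> carrier G" "v \<in> carrier G" for u v
    proof (cases "equiv_under p' u v")
      case True
      \<comment> \<open>The difference of \<open>u\<close> and \<open>v\<close> is fixed by the retraction.\<close>
      then have "inv u \<otimes> v \<in> unit_class G p'" using equiv_iff_unit_class[OF p' c] by simp
      from fix_on[OF this] have "inv (\<pi> u) \<otimes> \<pi> v = inv u \<otimes> v" using c by simp
      then have "(\<pi> u, \<pi> v) \<in> p \<longleftrightarrow> (u, v) \<in> p"
        using ZR_diff_iff(1)[OF p c] ZR_diff_iff(1)[OF p \<pi>c[OF c(1)] \<pi>c[OF c(2)]] by simp
      then show ?thesis
        using True c by (auto simp: preorder_comp_def q_def strict_below_def equiv_under_def)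
    next
      case False
      then show ?thesis
        using ZR_total[OF p c] sub
        by (auto simp: preorder_comp_def strict_below_def equiv_under_def)
    qed
    have comp_carrier: "preorder_comp p' q \<subseteq> carrier G \<times> carrier G"
      using ZR_carrier[OF p'] by (auto simp: preorder_comp_def strict_below_def equiv_under_def)
    show ?thesis
    proof (intro equalityI subrelI)
      show "(u, v) \<in> preorder_comp p' q" if "(u, v) \<in> p" for u v
        using agree ZR_carrier[OF p that] that by simp
      show "(u, v) \<in> p" if "(u, v) \<in> preorder_comp p' q" for u v
        using agree comp_carrier that by blast
    qed
  qed
  have q_class: "x \<in> unit_class G q \<longleftrightarrow> x \<in> carrier G \<and> \<pi> x \<in> unit_class G p" for x
    using \<pi>c by (auto simp: unit_class_def q_def equiv_under_def)
  have "unit_class G p' \<noteq> carrier G"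
    using unit_class_strict_mono[OF p' trivial_in_ZR[OF group_axioms] ZR_subset_trivial[OF p']
        nontriv] by (simp add: unit_class_trivial)
  then obtain x where x: "x \<in> carrier G" "x \<notin> unit_class G p'"
    by (auto simp: unit_class_def)
  have \<pi>x: "\<pi> x \<in> unit_class G p'" using range x by auto
  have "\<pi> (inv (\<pi> x) \<otimes> x) = \<one>" using x fix_on[OF \<pi>x] by simp
  then have "inv (\<pi> x) \<otimes> x \<in> unit_class G q"
    using x subgroup.one_closed[OF subgroup_unit_class[OF p]] by (simp add: q_class)
  moreover have "inv (\<pi> x) \<otimes> x \<notin> unit_class G p"
  proof
    assume "inv (\<pi> x) \<otimes> x \<in> unit_class G p"
    then have "inv (\<pi> x) \<otimes> x \<in> unit_class G p'"
      using unit_class_mono[OF sub, of G] by blast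
    with \<pi>x have "\<pi> x \<otimes> (inv (\<pi> x) \<otimes> x) \<in> unit_class G p'"
      by (rule subgroup.m_closed[OF subgroup_unit_class[OF p']])
    then show False using x by (simp add: m_assoc[symmetric])
  qed
  moreover have "unit_class G p \<subseteq> unit_class G q"
  proof
    fix y assume y: "y \<in> unit_class G p"
    then have "\<pi> y = y" using fix_on unit_class_mono[OF sub, of G] by blast
    then show "y \<in> unit_class G q" using y by (simp add: q_class) (simp add: unit_class_def)
  qed
  ultimately show "unit_class G p \<subset> unit_class G q" by blast
qed

lemma rank_one_decomposition:
  fixes corank :: "'a set \<Rightarrow> nat"
  assumes corank: "\<And>H H'. isolated_subgroup G H \<Longrightarrow> isolated_subgroup G H' \<Longrightarrow> H \<subset> H' \<Longrightarrow>
      corank H' < corank H"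
    and retract: "\<And>H. isolated_subgroup G H \<Longrightarrow>
      \<exists>\<pi>\<in>hom G G. \<pi> ` carrier G \<subseteq> H \<and> (\<forall>x\<in>H. \<pi> x = x)"
    and "p \<in> ZR G" "p \<noteq> trivial_preorder G"
  shows "\<exists>ps. ps \<noteq> [] \<and> length ps \<le> corank (unit_class G p) \<and>
    (\<forall>q\<in>set ps. rank_one G q) \<and> p = preorder_comp_list G ps"
  using assms(3,4)
proof (induction "corank (unit_class G p)" arbitrary: p rule: less_induct)
  case less
  obtain p' where r: "rank_one G p'" and sub: "p \<subseteq> p'"
    using exists_rank_one_coarsening[of corank, OF corank less.prems] by blast
  have p': "p' \<in> ZR G" "p' \<noteq> trivial_preorder G" using r by (auto simp: rank_one_def)
  obtain \<pi> where "\<pi> \<in> hom G G" "\<pi> ` carrier G \<subseteq> unit_class G p'"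
    "\<And>x. x \<in> unit_class G p' \<Longrightarrow> \<pi> x = x"
    using retract[OF isolated_unit_class[OF p'(1)]] by blast
  from split_off_coarsening[OF less.prems(1) p'(1) sub p'(2) this]
  obtain q where q: "q \<in> ZR G" "p = preorder_comp p' q" "unit_class G p \<subset> unit_class G q" .
  have lt: "corank (unit_class G q) < corank (unit_class G p)"
    using q less.prems by (intro corank isolated_unit_class) auto
  show ?case
  proof (cases "q = trivial_preorder G")
    case True
    then have "p = preorder_comp_list G [p']"
      using q(2) by (simp add: preorder_comp_list_def)
    then show ?thesis using lt r by (intro exI[of _ "[p']"]) auto
  next
    case False
    from less.hyps[OF lt q(1) this] obtain qs where
      "length qs \<le> corank (unit_class G q)" "\<forall>q\<in>set qs. rank_one G q"
      "q = preorder_comp_list G qs" by blast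
    then show ?thesis using lt r q(2)
      by (intro exI[of _ "p' # qs"]) (auto simp: preorder_comp_list_Cons)
  qed
qed

end

section \<open>Codimension of subspaces of arbitrary vector spaces\<close>

text \<open>
  The span operator is a parameter, so that the definition applies to every scalar multiplication.
\<close>

definition codim :: "('b set \<Rightarrow> 'b set) \<Rightarrow> 'b set \<Rightarrow> nat" where
  "codim sp U = (LEAST k. \<exists>S. finite S \<and> card S = k \<and> sp (U \<union> S) = UNIV)"

context vector_space
begin

lemma codim_le: "finite S \<Longrightarrow> span (U \<union> S) = UNIV \<Longrightarrow> codim span U \<le> card S"
  unfolding codim_def by (rule Least_le) blast

lemma span_exchange_relative:
  assumes "finite S" "x \<in> span (U \<union> S)" "x \<notin> span U"
  shows "\<exists>s\<in>S. s \<in> span (insert x (U \<union> (S - {s})))"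
  using assms
proof (induction S rule: finite_induct)
  case (insert t T)
  show ?case
  proof (cases "x \<in> span (U \<union> T)")
    case True
    then obtain s where s: "s \<in> T" "s \<in> span (insert x (U \<union> (T - {s})))"
      using insert by blast
    moreover have "span (insert x (U \<union> (T - {s}))) \<subseteq> span (insert x (U \<union> (insert t T - {s})))"
      by (rule span_mono) auto
    ultimately show ?thesis by blast
  next
    case False
    have "t \<in> span (insert x (U \<union> T))"
      by (rule in_span_insert[OF _ False]) (use insert.prems in simp)
    then show ?thesis using insert.hyps by auto
  qed
qed auto

lemma codim_strict_antimono:
  assumes U: "subspace U" and sub: "U \<subset> U'"
    and S0: "finite S0" "span (U \<union> S0) = UNIV"
  shows "codim span U' < codim span U"
proof -
  have "\<exists>S. finite S \<and> card S = codim span U \<and> span (U \<union> S) = UNIV"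
    unfolding codim_def by (rule LeastI_ex) (use S0 in blast)
  then obtain S where S: "finite S" "card S = codim span U" "span (U \<union> S) = UNIV" by blast
  obtain x where x: "x \<in> U'" "x \<notin> U" using sub by blast
  then have "x \<notin> span U" using span_minimal[OF order_refl U] by blast
  then obtain s where s: "s \<in> S" "s \<in> span (insert x (U \<union> (S - {s})))"
    using span_exchange_relative[of S x U] S by auto
  have "span (insert x (U \<union> (S - {s}))) \<subseteq> span (U' \<union> (S - {s}))"
    by (rule span_mono) (use x sub in auto)
  with s have "U \<union> S \<subseteq> span (U' \<union> (S - {s}))"
    using sub span_superset[of "U' \<union> (S - {s})"] by auto
  then have "span (U \<union> S) \<subseteq> span (U' \<union> (S - {s}))"
    by (intro span_minimal) auto
  then have "codim span U' \<le> card (S - {s})"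
    using S by (intro codim_le) auto
  also have "\<dots> < card S" using S(1) s(1) by (rule card_Diff1_less)
  finally show ?thesis using S by simp
qed

lemma subspace_retraction:
  assumes "subspace U"
  obtains \<pi> where "Vector_Spaces.linear scale scale \<pi>" "range \<pi> \<subseteq> U" "\<And>x. x \<in> U \<Longrightarrow> \<pi> x = x"
proof -
  interpret vector_space_pair scale scale by unfold_locales
  have "Vector_Spaces.linear scale scale (\<lambda>x. x)" by (rule linear_ident)
  then show thesis
    using linear_exists_left_inverse_on[OF _ assms, of "\<lambda>x. x"] that by auto
qed

end

section \<open>Isolated subgroups of rational coordinate space\<close>

text \<open>
  Since \<open>carrier_vec n\<close> is not a type, linear algebra takes place in the vector space of all rational
  sequences. A subspace of \<open>carrier_vec n\<close> is represented there by its preimage under the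
  truncation \<open>vec n\<close>, which is surjective, so that the preimage has the same codimension.
\<close>

interpretation rat_seq: vector_space "\<lambda>(c::rat) (f::nat \<Rightarrow> rat) i. c * f i"
  by unfold_locales (auto simp: fun_eq_iff algebra_simps)

definition lifted :: "nat \<Rightarrow> rat vec set \<Rightarrow> (nat \<Rightarrow> rat) set" where
  "lifted n H = {f. vec n f \<in> H}"

lemma rat_space_pow:
  assumes "x \<in> carrier_vec n"
  shows "x [^]\<^bsub>rat_space n\<^esub> (k::nat) = of_nat k \<cdot>\<^sub>v x"
proof -
  interpret comm_group "rat_space n" by (rule comm_group_vec)
  show ?thesis
    using assms
    by (induction k) (auto simp: monoid_vec_simps algebra_simps)
qed

lemma rat_space_inv:
  assumes "x \<in> carrier_vec n"
  shows "inv\<^bsub>rat_space n\<^esub> x = - x"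
proof -
  interpret comm_group "rat_space n" by (rule comm_group_vec)
  show ?thesis
    by (rule inv_equality) (use assms in \<open>auto simp: monoid_vec_simps\<close>)
qed

text \<open>
  A fraction \<open>a / b\<close> acts on an isolated subgroup because the \<open>b\<close>-fold multiple of the result is the
  \<open>a\<close>-fold multiple of the given element.
\<close>

lemma isolated_smult_closed:
  assumes iso: "isolated_subgroup (rat_space n) H" and x: "x \<in> H"
  shows "c \<cdot>\<^sub>v x \<in> H"
proof -
  interpret comm_group "rat_space n" by (rule comm_group_vec)
  have sub: "subgroup H (rat_space n)" using iso by (simp add: isolated_subgroup_def)
  have xc: "x \<in> carrier_vec n"
    using subgroup.mem_carrier[OF sub x] by (simp add: monoid_vec_simps)
  have nonneg: "d \<cdot>\<^sub>v x \<in> H" if "d \<ge> 0" for d :: rat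
  proof -
    obtain a b where ab: "quotient_of d = (a, b)" by fastforce
    have b: "b > 0" using quotient_of_denom_pos[OF ab] .
    have d: "d = of_int a / of_int b" using quotient_of_div[OF ab] .
    have a: "a \<ge> 0" using that b d by (simp add: zero_le_divide_iff)
    have "of_nat (nat b) * d = of_nat (nat a)" using a b d by simp
    then have "(d \<cdot>\<^sub>v x) [^]\<^bsub>rat_space n\<^esub> nat b = x [^]\<^bsub>rat_space n\<^esub> nat a"
      using xc by (simp add: rat_space_pow smult_smult_assoc)
    moreover have "x [^]\<^bsub>rat_space n\<^esub> (k::nat) \<in> H" for k
      using x
      by (induction k) (auto simp: subgroup.one_closed[OF sub] subgroup.m_closed[OF sub])
    moreover have "d \<cdot>\<^sub>v x \<in> carrier (rat_space n)" using xc by (simp add: monoid_vec_simps)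
    ultimately show ?thesis
      using iso b unfolding isolated_subgroup_def by (metis zero_less_nat_eq)
  qed
  show ?thesis
  proof (cases "c \<ge> 0")
    case False
    then have "(- c) \<cdot>\<^sub>v x \<in> H" by (intro nonneg) simp
    moreover have "- ((- c) \<cdot>\<^sub>v x) = c \<cdot>\<^sub>v x" by auto
    ultimately show ?thesis
      using subgroup.m_inv_closed[OF sub, of "(- c) \<cdot>\<^sub>v x"] xc by (simp add: rat_space_inv)
  qed (rule nonneg)
qed

lemma subspace_lifted:
  assumes iso: "isolated_subgroup (rat_space n) H"
  shows "rat_seq.subspace (lifted n H)"
proof -
  have sub: "subgroup H (rat_space n)" using iso by (simp add: isolated_subgroup_def)
  show ?thesis
  proof (rule rat_seq.subspaceI)
    have "vec n (0 :: nat \<Rightarrow> rat) = 0\<^sub>v n" by auto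
    then show "0 \<in> lifted n H"
      using subgroup.one_closed[OF sub] by (simp add: lifted_def monoid_vec_simps)
  next
    fix f g assume "f \<in> lifted n H" "g \<in> lifted n H"
    moreover have "vec n (f + g) = vec n f + vec n g" by auto
    ultimately show "f + g \<in> lifted n H"
      using subgroup.m_closed[OF sub] by (simp add: lifted_def monoid_vec_simps)
  next
    fix c f assume "f \<in> lifted n H"
    moreover have "vec n (\<lambda>i. c * f i) = c \<cdot>\<^sub>v vec n f" by auto
    ultimately show "(\<lambda>i. c * f i) \<in> lifted n H"
      using isolated_smult_closed[OF iso] by (simp add: lifted_def)
  qed
qed

lemma lifted_strict_mono:
  assumes "H \<subset> H'" "H' \<subseteq> carrier_vec n"
  shows "lifted n H \<subset> lifted n H'"
proof -
  obtain x where x: "x \<in> H'" "x \<notin> H" using assms by blast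
  then have "x \<in> carrier_vec n" using assms by blast
  then have "vec n (\<lambda>i. x $ i) = x" by auto
  then have "(\<lambda>i. x $ i) \<in> lifted n H' - lifted n H" using x by (simp add: lifted_def)
  then show ?thesis using assms by (auto simp: lifted_def)
qed

lemma lifted_plus_unit_span:
  assumes "isolated_subgroup (rat_space n) H"
  defines "e \<equiv> \<lambda>(i::nat) j. of_bool (i = j) :: rat"
  shows "rat_seq.span (lifted n H \<union> e ` {..<n}) = UNIV"
proof -
  have "f \<in> rat_seq.span (lifted n H \<union> e ` {..<n})" for f
  proof -
    define g where "g = (\<Sum>i<n. (\<lambda>j. f i * e i j))"
    have g_sum: "g j = (\<Sum>i<n. f i * e i j)" for j
      unfolding g_def by (induction n) auto
    have g: "g j = f j" if "j < n" for j
      unfolding g_sum e_def using that by (simp add: of_bool_def if_distrib cong: if_cong)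
    have "vec n (f - g) = vec n 0" using g by auto
    then have "f - g \<in> lifted n H"
      using rat_seq.subspace_0[OF subspace_lifted[OF assms(1)]] by (simp add: lifted_def)
    then have "f - g \<in> rat_seq.span (lifted n H \<union> e ` {..<n})"
      by (intro rat_seq.span_base) simp
    moreover have "g \<in> rat_seq.span (lifted n H \<union> e ` {..<n})"
      unfolding g_def by (intro rat_seq.span_sum rat_seq.span_scale rat_seq.span_base) auto
    ultimately have "f - g + g \<in> rat_seq.span (lifted n H \<union> e ` {..<n})"
      by (rule rat_seq.span_add)
    then show ?thesis by simp
  qed
  then show ?thesis by auto
qed

lemma codim_lifted_le:
  assumes "isolated_subgroup (rat_space n) H"
  shows "codim rat_seq.span (lifted n H) \<le> n"
  using rat_seq.codim_le[OF _ lifted_plus_unit_span[OF assms]] card_image_le[of "{..<n}"]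
  by (metis card_lessThan finite_imageI finite_lessThan order_trans)

lemma codim_lifted_strict_antimono:
  assumes "isolated_subgroup (rat_space n) H" "isolated_subgroup (rat_space n) H'" "H \<subset> H'"
  shows "codim rat_seq.span (lifted n H') < codim rat_seq.span (lifted n H)"
proof (rule rat_seq.codim_strict_antimono)
  show "rat_seq.subspace (lifted n H)" using assms(1) by (rule subspace_lifted)
  show "lifted n H \<subset> lifted n H'"
    using assms(2,3) subgroup.subset[of H' "rat_space n"]
    by (intro lifted_strict_mono) (auto simp: isolated_subgroup_def monoid_vec_simps)
  show "rat_seq.span (lifted n H \<union> (\<lambda>i j. of_bool (i = j)) ` {..<n}) = UNIV"
    using lifted_plus_unit_span[OF assms(1)] .
qed simp

lemma isolated_subgroup_retract:
  assumes iso: "isolated_subgroup (rat_space n) H"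
  shows "\<exists>\<pi>\<in>hom (rat_space n) (rat_space n).
    \<pi> ` carrier (rat_space n) \<subseteq> H \<and> (\<forall>x\<in>H. \<pi> x = x)"
proof -
  obtain \<sigma> where lin: "Vector_Spaces.linear (\<lambda>c f i. c * f i) (\<lambda>c f i. c * f i) \<sigma>"
    and range: "range \<sigma> \<subseteq> lifted n H" and fix_on: "\<And>f. f \<in> lifted n H \<Longrightarrow> \<sigma> f = f"
    using rat_seq.subspace_retraction[OF subspace_lifted[OF iso]] by blast
  \<comment> \<open>Entries of a vector beyond its dimension are unspecified, so they are set to 0, which keeps
    the lift additive.\<close>
  define lift :: "rat vec \<Rightarrow> nat \<Rightarrow> rat" where "lift x = (\<lambda>i. if i < n then x $ i else 0)" for x
  define \<pi> where "\<pi> x = vec n (\<sigma> (lift x))" for x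
  have H: "H \<subseteq> carrier_vec n"
    using iso subgroup.subset[of H "rat_space n"]
    by (simp add: isolated_subgroup_def monoid_vec_simps)
  have "\<pi> (x + y) = \<pi> x + \<pi> y" if "x \<in> carrier_vec n" "y \<in> carrier_vec n" for x y
  proof -
    have "lift (x + y) = lift x + lift y" using that by (auto simp: lift_def fun_eq_iff)
    then show ?thesis using Vector_Spaces.linear.axioms(3)[OF lin]
      by (auto simp: \<pi>_def module_hom_def module_hom_axioms_def)
  qed
  then have "\<pi> \<in> hom (rat_space n) (rat_space n)"
    by (auto simp: hom_def monoid_vec_simps \<pi>_def)
  moreover have "\<pi> x \<in> H" for x using range by (auto simp: \<pi>_def lifted_def)
  moreover have "\<pi> x = x" if x: "x \<in> H" for x
  proof -
    have "x \<in> carrier_vec n" using x H by blast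
    then have "vec n (lift x) = x" by (intro eq_vecI) (auto simp: lift_def)
    then show ?thesis using fix_on[of "lift x"] x by (simp add: \<pi>_def lifted_def)
  qed
  ultimately show ?thesis by auto
qed

section \<open>Preorders on rational coordinate space\<close>

theorem theorem3p18:
  fixes n :: nat and p :: "rat vec rel"
  assumes "p \<in> ZR (rat_space n) - {trivial_preorder (rat_space n)}"
  shows "\<exists>ps. length ps = n
    \<and> (\<forall>q\<in>set ps. q \<in> ZR (rat_space n) \<and> has_rank (rat_space n) q (card_of {..<1::nat}))
    \<and> p = preorder_comp_list (rat_space n) ps"
proof -
  interpret comm_group "rat_space n" by (rule comm_group_vec)
  have p: "p \<in> ZR (rat_space n)" "p \<noteq> trivial_preorder (rat_space n)" using assms by auto
  obtain ps where ps: "ps \<noteq> []" "\<forall>q\<in>set ps. rank_one (rat_space n) q"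
    "p = preorder_comp_list (rat_space n) ps"
    and "length ps \<le> codim rat_seq.span (lifted n (unit_class (rat_space n) p))"
    using rank_one_decomposition[where corank = "\<lambda>H. codim rat_seq.span (lifted n H)",
        OF codim_lifted_strict_antimono isolated_subgroup_retract p] by blast
  then have len: "length ps \<le> n"
    using codim_lifted_le[OF isolated_unit_class[OF p(1)]] by simp
  obtain q qs where q: "ps = q # qs" using ps(1) by (cases ps) auto
  let ?ps = "replicate (n - length ps) q @ ps"
  have "length ?ps = n" using len by simp
  moreover have "\<forall>r\<in>set ?ps. rank_one (rat_space n) r" using ps(2) q by auto
  moreover have "p = preorder_comp_list (rat_space n) ?ps"
    using ps(3) unfolding q by (simp only: preorder_comp_list_repeat_head)
  moreover have "q \<in> ZR (rat_space n)" if "rank_one (rat_space n) q" for q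
    using that by (simp add: rank_one_def)
  ultimately show ?thesis
    using rank_one_has_rank[OF group_axioms] by (intro exI[of _ ?ps]) simp
qed

end
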